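(* For a positive integer $n$, let $F(n)$ be the number of triangle quadruples $Q=(a,b,c,d)$ with height $H(Q)=\sqrt{a^2+b^2+c^2+d^2}\le n$. Then $F(n)=O(n^2\log^3 n)$.
   Context: A triangle quadruple is a quadruple $(a,b,c,d)$ of nonnegative integers satisfying $3(a^2+b^2+c^2+d^2)=(a+b+c+d)^2$. *)

theory Defs
  imports Complex_Main "HOL-Library.Landau_Symbols"
begin

type_synonym quadruple = "nat \<times> nat \<times> nat \<times> nat"

definition triangle_quadruple :: "quadruple \<Rightarrow> bool" where
  "triangle_quadruple = (\<lambda>(a, b, c, d).
     3 * (a\<^sup>2 + b\<^sup>2 + c\<^sup>2 + d\<^sup>2) = (a + b + c + d)\<^sup>2)"

definition height :: "quadruple \<Rightarrow> real" where
  "height = (\<lambda>(a, b, c, d). sqrt (real (a\<^sup>2 + b\<^sup>2 + c\<^sup>2 + d\<^sup>2)))"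

text \<open>Quadruples are ordered. The set counted is finite by the lemma below, so \<open>card\<close> is the
  true count.\<close>

definition triangle_quadruple_count :: "nat \<Rightarrow> nat" where
  "triangle_quadruple_count n = card {Q. triangle_quadruple Q \<and> height Q \<le> real n}"

lemma finite_triangle_quadruples_height_le:
  "finite {Q. triangle_quadruple Q \<and> height Q \<le> real n}"
proof (rule finite_subset)
  show "{Q. triangle_quadruple Q \<and> height Q \<le> real n} \<subseteq> {..n} \<times> {..n} \<times> {..n} \<times> {..n}"
  proof
    fix Q assume Q: "Q \<in> {Q. triangle_quadruple Q \<and> height Q \<le> real n}"
    obtain a b c d where Q_eq: "Q = (a, b, c, d)"
      by (cases Q)
    from Q have "height (a, b, c, d) \<le> real n"
      by (simp add: Q_eq)
    then have "real (a\<^sup>2 + b\<^sup>2 + c\<^sup>2 + d\<^sup>2) \<le> (real n)\<^sup>2"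
      unfolding height_def prod.case by (rule sqrt_le_D)
    then have "real (a\<^sup>2 + b\<^sup>2 + c\<^sup>2 + d\<^sup>2) \<le> real (n\<^sup>2)"
      by simp
    then have le: "a\<^sup>2 + b\<^sup>2 + c\<^sup>2 + d\<^sup>2 \<le> n\<^sup>2"
      by (simp only: of_nat_le_iff)
    have "a\<^sup>2 \<le> n\<^sup>2" "b\<^sup>2 \<le> n\<^sup>2" "c\<^sup>2 \<le> n\<^sup>2" "d\<^sup>2 \<le> n\<^sup>2"
      using le by linarith+
    then show "Q \<in> {..n} \<times> {..n} \<times> {..n} \<times> {..n}"
      by (simp add: Q_eq power2_nat_le_eq_le)
  qed
qed simp

end

theory Submission
  imports Defs "HOL-Computational_Algebra.Primes" "HOL-Analysis.Summation_Tests"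
begin

text \<open>Let \<open>\<omega>\<close> be a primitive cube root of unity and \<open>N(x + y\<omega>) = x\<^sup>2 - xy + y\<^sup>2\<close> the norm of
  \<open>\<int>[\<omega>]\<close>. Setting \<open>3v = 2d - a - b - c\<close> and \<open>u = a + b - d + 2v\<close>, a triangle quadruple becomes a
  solution of \<open>ab = N(u + v\<omega>)\<close>, that is, a singular positive semidefinite Hermitian matrix with
  diagonal \<open>a, b\<close> and off-diagonal entry \<open>u + v\<omega>\<close>. Euclidean descent in \<open>\<int>[\<omega>]\<close> shows that every
  such matrix is \<open>t\<close> times \<open>(p, q)\<^sup>T (p\<^sup>*, q\<^sup>*)\<close> with a positive integer \<open>t\<close> and \<open>p, q \<in> \<int>[\<omega>]\<close>.
  For given \<open>t \<le> n\<close> the inequalities \<open>t N(p) \<le> n\<close> and \<open>t N(q) \<le> n\<close> leave \<open>O((n/t)\<^sup>2)\<close> pairs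
  \<open>(p, q)\<close>, so the count is even \<open>O(n\<^sup>2)\<close>, as \<open>\<Sum> 1/t\<^sup>2\<close> converges.\<close>

section \<open>The norm form of the Eisenstein integers\<close>

definition eis_norm :: "int \<Rightarrow> int \<Rightarrow> int" where
  "eis_norm x y = x\<^sup>2 - x * y + y\<^sup>2"

text \<open>Since \<open>\<omega>\<^sup>2 = - 1 - \<omega>\<close>, the conjugate of
  \<open>x + y \<omega>\<close> is \<open>(x - y) - y \<omega>\<close>.\<close>

lemma eis_norm_conj: "eis_norm (x - y) (- y) = eis_norm x y"
  by (simp add: eis_norm_def power2_eq_square algebra_simps)

lemma squares_le_eis_norm:
  "x\<^sup>2 \<le> 2 * eis_norm x y" "y\<^sup>2 \<le> 2 * eis_norm x y"
proof -
  have "2 * eis_norm x y - x\<^sup>2 = (x - y)\<^sup>2 + y\<^sup>2" "2 * eis_norm x y - y\<^sup>2 = (x - y)\<^sup>2 + x\<^sup>2"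
    by (simp_all add: eis_norm_def power2_eq_square algebra_simps)
  then show "x\<^sup>2 \<le> 2 * eis_norm x y" "y\<^sup>2 \<le> 2 * eis_norm x y"
    using zero_le_power2[of "x - y"] zero_le_power2[of x] zero_le_power2[of y] by linarith+
qed

lemma eis_norm_nonneg: "0 \<le> eis_norm x y"
  using squares_le_eis_norm(1)[of x y] zero_le_power2[of x] by linarith

lemma eis_norm_eq_0_iff: "eis_norm x y = 0 \<longleftrightarrow> x = 0 \<and> y = 0"
proof
  assume "eis_norm x y = 0"
  then show "x = 0 \<and> y = 0"
    using squares_le_eis_norm(1)[of x y] squares_le_eis_norm(2)[of y x] by simp
qed (simp add: eis_norm_def)

lemma obtain_nearest_multiple:
  fixes a u :: int
  assumes "0 < a"
  obtains k where "2 * \<bar>u - a * k\<bar> \<le> a"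
proof -
  \<comment> \<open>This is the floor of \<open>u / a + 1 / 2\<close>, so \<open>u / a\<close>
    rounded to a nearest integer.\<close>
  define k where "k = (2 * u + a) div (2 * a)"
  have "2 * u + a = 2 * a * k + (2 * u + a) mod (2 * a)"
    by (simp add: k_def)
  then have "2 * (u - a * k) = (2 * u + a) mod (2 * a) - a"
    by (simp add: algebra_simps)
  moreover have "0 \<le> (2 * u + a) mod (2 * a)" "(2 * u + a) mod (2 * a) < 2 * a"
    using assms by simp_all
  ultimately have "- a \<le> 2 * (u - a * k)" "2 * (u - a * k) \<le> a"
    by simp_all
  then have "2 * \<bar>u - a * k\<bar> \<le> a"
    by (simp add: abs_if)
  then show thesis by (rule that)
qed

text \<open>Each of the three terms contributes at most \<open>a\<^sup>2 / 4\<close>. The strict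
  bound is what makes the Euclidean descent terminate.\<close>

lemma eis_norm_less_square:
  assumes "0 < a" "2 * \<bar>x\<bar> \<le> a" "2 * \<bar>y\<bar> \<le> a"
  shows "eis_norm x y < a\<^sup>2"
proof -
  have "4 * x\<^sup>2 \<le> a\<^sup>2" "4 * y\<^sup>2 \<le> a\<^sup>2"
    using power_mono[OF assms(2), of 2] power_mono[OF assms(3), of 2]
    by (simp_all add: power_mult_distrib)
  moreover have "4 * (\<bar>x\<bar> * \<bar>y\<bar>) \<le> a\<^sup>2"
    using mult_mono[OF assms(2,3)] assms(1) by (simp add: power2_eq_square)
  moreover have "- (x * y) \<le> \<bar>x\<bar> * \<bar>y\<bar>"
    by (metis abs_ge_minus_self abs_mult)
  moreover have "0 < a\<^sup>2"
    using assms(1) by simp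
  ultimately show ?thesis
    unfolding eis_norm_def by linarith
qed

section \<open>Factorization of singular Hermitian matrices\<close>

text \<open>With \<open>p = p1 + p2 \<omega>\<close> and \<open>q = q1 + q2 \<omega>\<close>, the last two equations say that
  \<open>u + v \<omega>\<close> is \<open>t\<close> times \<open>p\<close> times the conjugate of \<open>q\<close>.\<close>

definition rank_one :: "int \<Rightarrow> int \<Rightarrow> int \<Rightarrow> int \<Rightarrow> int \<Rightarrow> int \<times> int \<Rightarrow> int \<times> int \<Rightarrow> bool" where
  "rank_one a b u v = (\<lambda>t (p1, p2) (q1, q2).
     a = t * eis_norm p1 p2 \<and> b = t * eis_norm q1 q2 \<and>
     u = t * (p1 * q1 - p1 * q2 + p2 * q2) \<and> v = t * (p2 * q1 - p1 * q2))"

text \<open>Exchanging the two basis vectors swaps the diagonal and conjugates the off-diagonal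
  entry.\<close>

lemma rank_one_swap:
  assumes "rank_one b a (u - v) (- v) t p q"
  shows "rank_one a b u v t q p"
proof -
  obtain p1 p2 q1 q2 where [simp]: "p = (p1, p2)" "q = (q1, q2)"
    by (cases p, cases q)
  have "b = t * eis_norm p1 p2" "a = t * eis_norm q1 q2"
    and uv: "u - v = t * (p1 * q1 - p1 * q2 + p2 * q2)" "- v = t * (p2 * q1 - p1 * q2)"
    using assms by (simp_all add: rank_one_def)
  moreover have "v = t * (q2 * p1 - q1 * p2)"
    using uv(2) by (simp add: algebra_simps)
  moreover from this have "u = t * (q1 * p1 - q1 * p2 + q2 * p2)"
    using uv(1) by (simp add: algebra_simps)
  ultimately show ?thesis
    by (simp add: rank_one_def)
qed

text \<open>The base change \<open>q \<mapsto> q + k\<^sup>* p\<close> with \<open>k = k1 + k2 \<omega>\<close>.\<close>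

lemma rank_one_shear:
  assumes "rank_one a b u v t (p1, p2) (q1, q2)"
  shows "rank_one a (b + (2 * u * k1 - u * k2 - v * k1 + 2 * v * k2) + a * eis_norm k1 k2)
           (u + a * k1) (v + a * k2) t (p1, p2)
           (q1 + (k1 - k2) * p1 + k2 * p2, q2 - k2 * p1 + k1 * p2)"
proof -
  have a: "a = t * eis_norm p1 p2" and b: "b = t * eis_norm q1 q2"
    and u: "u = t * (p1 * q1 - p1 * q2 + p2 * q2)" and v: "v = t * (p2 * q1 - p1 * q2)"
    using assms by (simp_all add: rank_one_def)
  show ?thesis
    unfolding rank_one_def a b u v
    by (simp add: eis_norm_def power2_eq_square algebra_simps)
qed

text \<open>Descent on the corner entry \<open>a\<close>: a shear reduces
  \<open>u + v \<omega>\<close> modulo \<open>a\<close>, so its norm falls below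
  \<open>a\<^sup>2\<close> and the other diagonal entry below \<open>a\<close>. Swapping puts that
  smaller entry in the corner.\<close>

lemma rank_one_exists:
  fixes a b u v :: int
  assumes "0 \<le> a" "0 \<le> b" "a * b = eis_norm u v"
  shows "\<exists>t>0. \<exists>p q. rank_one a b u v t p q"
  using assms
proof (induction "nat a" arbitrary: a b u v rule: less_induct)
  case less
  show ?case
  proof (cases "a = 0")
    case True
    then have "u = 0" "v = 0"
      using less.prems(3) eis_norm_eq_0_iff[of u v] by simp_all
    show ?thesis
    proof (cases "b = 0")
      case True
      then have "rank_one a b u v 1 (0, 0) (0, 0)"
        using \<open>a = 0\<close> \<open>u = 0\<close> \<open>v = 0\<close> by (simp add: rank_one_def eis_norm_def)
      then show ?thesis by (meson zero_less_one)
    next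
      case False
      then have "rank_one a b u v b (0, 0) (1, 0)" "0 < b"
        using \<open>a = 0\<close> \<open>u = 0\<close> \<open>v = 0\<close> less.prems(2) by (simp_all add: rank_one_def eis_norm_def)
      then show ?thesis by blast
    qed
  next
    case False
    then have a: "0 < a" using less.prems(1) by simp
    obtain k1 where k1: "2 * \<bar>u - a * k1\<bar> \<le> a" using obtain_nearest_multiple[OF a] by blast
    obtain k2 where k2: "2 * \<bar>v - a * k2\<bar> \<le> a" using obtain_nearest_multiple[OF a] by blast
    define u' v' where "u' = u - a * k1" and "v' = v - a * k2"
    \<comment> \<open>The lower diagonal entry after the shear by \<open>- k\<close>; the bracket is
      the trace of \<open>u + v \<omega>\<close> times the conjugate of \<open>k\<close>.\<close>
    define b' where "b' = b - (2 * u * k1 - u * k2 - v * k1 + 2 * v * k2) + a * eis_norm k1 k2"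
    have "a * b' = a * b - a * (2 * u * k1 - u * k2 - v * k1 + 2 * v * k2) + a\<^sup>2 * eis_norm k1 k2"
      by (simp add: b'_def power2_eq_square algebra_simps)
    also have "\<dots> = eis_norm u' v'"
      unfolding less.prems(3)
      by (simp add: u'_def v'_def eis_norm_def power2_eq_square algebra_simps)
    finally have ab': "a * b' = eis_norm u' v'" .
    have "0 \<le> a * b'" unfolding ab' by (rule eis_norm_nonneg)
    then have b'_nonneg: "0 \<le> b'" using a by (simp add: zero_le_mult_iff)
    have "a * b' < a * a"
      using eis_norm_less_square[OF a k1 k2] ab' by (simp add: u'_def v'_def power2_eq_square)
    then have b'_less: "b' < a" using a by simp
    have "\<exists>t>0. \<exists>p q. rank_one b' a (u' - v') (- v') t p q"
    proof (rule less.hyps)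
      show "b' * a = eis_norm (u' - v') (- v')"
        using ab' by (simp add: eis_norm_conj mult.commute)
    qed (use a b'_nonneg b'_less in simp_all)
    then obtain t p q where "0 < t" "rank_one a b' u' v' t q p"
      using rank_one_swap by blast
    moreover obtain p1 p2 q1 q2 where "q = (p1, p2)" "p = (q1, q2)"
      by (cases p, cases q)
    ultimately have "rank_one a b' u' v' t (p1, p2) (q1, q2)" by simp
    \<comment> \<open>The shear by \<open>+ k\<close> undoes the reduction and carries the
      factorization back to the original matrix.\<close>
    from rank_one_shear[OF this, of k1 k2]
    have "\<exists>p q. rank_one a (b' + (2 * u' * k1 - u' * k2 - v' * k1 + 2 * v' * k2) + a * eis_norm k1 k2)
           (u' + a * k1) (v' + a * k2) t p q"
      by blast
    moreover have "b' + (2 * u' * k1 - u' * k2 - v' * k1 + 2 * v' * k2) + a * eis_norm k1 k2 = b"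
      by (simp add: b'_def u'_def v'_def eis_norm_def power2_eq_square algebra_simps)
    moreover have "u' + a * k1 = u" "v' + a * k2 = v"
      by (simp_all add: u'_def v'_def)
    ultimately show ?thesis using \<open>0 < t\<close> by metis
  qed
qed

section \<open>Parametrization of triangle quadruples\<close>

lemma triangle_quadruple_eisenstein:
  assumes "triangle_quadruple (a, b, c, d)"
  obtains u v where "int c = int a + int b - 2 * u + v" "int d = int a + int b - u + 2 * v"
    "int a * int b = eis_norm u v"
proof -
  define A B C D where "A = int a" and "B = int b" and "C = int c" and "D = int d"
  have eq: "3 * (A\<^sup>2 + B\<^sup>2 + C\<^sup>2 + D\<^sup>2) = (A + B + C + D)\<^sup>2"
  proof -
    have "int (3 * (a\<^sup>2 + b\<^sup>2 + c\<^sup>2 + d\<^sup>2)) = int ((a + b + c + d)\<^sup>2)"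
      using assms by (simp add: triangle_quadruple_def)
    then show ?thesis by (simp add: A_def B_def C_def D_def)
  qed
  \<comment> \<open>Completing the square in \<open>D\<close> exposes the factor 3, which makes
    \<open>v\<close> an integer.\<close>
  have "(2 * D - A - B - C)\<^sup>2 = 3 * (4 * (A * B) - (A + B - C)\<^sup>2)"
    using eq by (simp add: power2_eq_square algebra_simps)
  then have "3 dvd (2 * D - A - B - C)\<^sup>2" by simp
  then have "3 dvd 2 * D - A - B - C"
    using prime_dvd_power[of "3 :: int"] by simp
  then obtain v where v: "2 * D - A - B - C = 3 * v" by blast
  define u where "u = A + B - D + 2 * v"
  have D: "D = A + B - u + 2 * v" by (simp add: u_def)
  moreover have C: "C = A + B - 2 * u + v" using v by (simp add: u_def)
  moreover have "A * B = eis_norm u v"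
    using eq unfolding C D by (simp add: eis_norm_def power2_eq_square algebra_simps)
  ultimately show thesis using that by (simp add: A_def B_def C_def D_def)
qed

text \<open>The entries are \<open>t\<close> times the norms of \<open>p\<close>, \<open>q\<close>,
  \<open>p - q\<close> and \<open>p + \<omega> q\<close>; hence \<open>nat\<close> truncates nothing
  for \<open>t \<ge> 0\<close>.\<close>

fun quadruple_of :: "int \<times> (int \<times> int) \<times> (int \<times> int) \<Rightarrow> quadruple" where
  "quadruple_of (t, (p1, p2), (q1, q2)) =
    (let a = t * eis_norm p1 p2; b = t * eis_norm q1 q2;
         u = t * (p1 * q1 - p1 * q2 + p2 * q2); v = t * (p2 * q1 - p1 * q2)
     in (nat a, nat b, nat (a + b - 2 * u + v), nat (a + b - u + 2 * v)))"

definition box :: "real \<Rightarrow> (int \<times> int) set" where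
  "box r = {- \<lfloor>r\<rfloor>..\<lfloor>r\<rfloor>} \<times> {- \<lfloor>r\<rfloor>..\<lfloor>r\<rfloor>}"

lemma finite_box [simp]: "finite (box r)"
  by (simp add: box_def)

lemma card_box_le:
  assumes "1 \<le> r"
  shows "real (card (box r)) \<le> 9 * r\<^sup>2"
proof -
  have "1 \<le> \<lfloor>r\<rfloor>" using assms by simp
  have "real (card {- \<lfloor>r\<rfloor>..\<lfloor>r\<rfloor>}) = 2 * of_int \<lfloor>r\<rfloor> + 1"
    using \<open>1 \<le> \<lfloor>r\<rfloor>\<close> by simp
  also have "\<dots> \<le> 3 * r"
    using assms of_int_floor_le[of r] by linarith
  finally have "(real (card {- \<lfloor>r\<rfloor>..\<lfloor>r\<rfloor>}))\<^sup>2 \<le> (3 * r)\<^sup>2"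
    by (rule power_mono) simp
  then show ?thesis
    by (simp add: box_def card_cartesian_product power2_eq_square)
qed

text \<open>A coordinate \<open>z\<close> has square at most twice the norm, so
  \<open>t * z\<^sup>2 \<le> 2 * n\<close>, whence the radius.\<close>

lemma mem_box_sqrt:
  assumes "0 < t" "t * eis_norm x y \<le> int n"
  shows "(x, y) \<in> box (sqrt (2 * real n / of_int t))"
proof -
  have "of_int z \<le> sqrt (2 * real n / of_int t) \<and> - of_int z \<le> sqrt (2 * real n / of_int t)"
    if "z\<^sup>2 \<le> 2 * eis_norm x y" for z
  proof -
    have "t * z\<^sup>2 \<le> t * (2 * eis_norm x y)"
      using that assms(1) by (intro mult_left_mono) auto
    with assms(2) have "t * z\<^sup>2 \<le> 2 * int n" by linarith
    then have "of_int (t * z\<^sup>2) \<le> (of_int (2 * int n) :: real)"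
      by (simp only: of_int_le_iff)
    then have "(of_int z)\<^sup>2 \<le> 2 * real n / of_int t"
      using assms(1) by (simp add: field_simps)
    then have "\<bar>of_int z\<bar> \<le> sqrt (2 * real n / of_int t)"
      by (metis real_sqrt_abs real_sqrt_le_mono)
    then show ?thesis by linarith
  qed
  from this[OF squares_le_eis_norm(1)] this[OF squares_le_eis_norm(2)]
  show ?thesis
    by (simp add: box_def le_floor_iff minus_le_iff)
qed

lemma triangle_quadruple_parametrization:
  assumes "triangle_quadruple Q" "height Q \<le> real n"
  shows "Q \<in> insert (0, 0, 0, 0) (\<Union>t\<in>{1..n}. quadruple_of `
           ({int t} \<times> box (sqrt (2 * real n / real t)) \<times> box (sqrt (2 * real n / real t))))"
proof -
  obtain a b c d where Q: "Q = (a, b, c, d)" by (cases Q)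
  have "sqrt (real (a\<^sup>2 + b\<^sup>2 + c\<^sup>2 + d\<^sup>2)) \<le> real n"
    using assms(2) by (simp add: Q height_def)
  then have "real (a\<^sup>2 + b\<^sup>2 + c\<^sup>2 + d\<^sup>2) \<le> (real n)\<^sup>2" by (rule sqrt_le_D)
  then have "real (a\<^sup>2 + b\<^sup>2 + c\<^sup>2 + d\<^sup>2) \<le> real (n\<^sup>2)" by simp
  then have "a\<^sup>2 + b\<^sup>2 + c\<^sup>2 + d\<^sup>2 \<le> n\<^sup>2" by (simp only: of_nat_le_iff)
  then have "a\<^sup>2 \<le> n\<^sup>2" "b\<^sup>2 \<le> n\<^sup>2" by linarith+
  then have le: "a \<le> n" "b \<le> n" by (simp_all add: power2_nat_le_eq_le)
  obtain u v where cd: "int c = int a + int b - 2 * u + v" "int d = int a + int b - u + 2 * v"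
    and ab: "int a * int b = eis_norm u v"
    using assms(1) triangle_quadruple_eisenstein unfolding Q by blast
  obtain t p q where "0 < t" and "rank_one (int a) (int b) u v t p q"
    using rank_one_exists[of "int a" "int b" u v] ab by auto
  moreover obtain p1 p2 q1 q2 where pq: "p = (p1, p2)" "q = (q1, q2)"
    by (cases p, cases q)
  ultimately have a: "int a = t * eis_norm p1 p2" and b: "int b = t * eis_norm q1 q2"
    and u: "u = t * (p1 * q1 - p1 * q2 + p2 * q2)" and v: "v = t * (p2 * q1 - p1 * q2)"
    by (simp_all add: rank_one_def)
  show ?thesis
  proof (cases "t \<le> int n")
    case True
    define m where "m = nat t"
    have m: "t = int m" "m \<in> {1..n}" using \<open>0 < t\<close> True by (auto simp: m_def)
    have "Q = quadruple_of (int m, p, q)"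
      unfolding pq quadruple_of.simps Let_def m(1)[symmetric] a[symmetric] b[symmetric]
        u[symmetric] v[symmetric]
      by (simp add: Q flip: cd)
    moreover have "p \<in> box (sqrt (2 * real n / real m))" "q \<in> box (sqrt (2 * real n / real m))"
      using mem_box_sqrt[OF \<open>0 < t\<close>, of p1 p2 n] mem_box_sqrt[OF \<open>0 < t\<close>, of q1 q2 n] a b le
      by (simp_all add: pq m(1))
    ultimately show ?thesis using m(2) by blast
  next
    case False
    \<comment> \<open>Multiples of \<open>t > n\<close> in the range from 0 to \<open>n\<close>
      vanish, so only the zero quadruple, inserted separately, has such a \<open>t\<close>.\<close>
    have zero: "z = 0" if "int z = t * y" "z \<le> n" for z y
    proof (rule ccontr)
      assume "z \<noteq> 0"
      then have "t \<le> int z" using that(1) by (intro zdvd_imp_le) auto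
      then show False using False that(2) by simp
    qed
    have "a = 0" "b = 0" using zero[OF a] zero[OF b] le by simp_all
    moreover from this have "u = 0" "v = 0" using ab eis_norm_eq_0_iff[of u v] by simp_all
    ultimately show ?thesis using cd Q by simp
  qed
qed

section \<open>Summation over the scaling factor\<close>

lemma summable_inverse_squares: "summable (\<lambda>k. 1 / real k ^ 2)"
  using inverse_power_summable[of 2, where ?'a = real] by (simp add: inverse_eq_divide)

lemma triangle_quadruple_count_le:
  "real (triangle_quadruple_count n) \<le> 1 + 324 * (\<Sum>k. 1 / real k ^ 2) * (real n)\<^sup>2"
proof -
  define B where "B = (\<lambda>t. {int t} \<times> box (sqrt (2 * real n / real t)) \<times> box (sqrt (2 * real n / real t)))"
  have "triangle_quadruple_count n \<le> card (insert (0, 0, 0, 0) (\<Union>t\<in>{1..n}. quadruple_of ` B t))"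
    unfolding triangle_quadruple_count_def
  proof (rule card_mono)
    show "{Q. triangle_quadruple Q \<and> height Q \<le> real n}
      \<subseteq> insert (0, 0, 0, 0) (\<Union>t\<in>{1..n}. quadruple_of ` B t)"
      unfolding B_def using triangle_quadruple_parametrization by blast
  qed (simp add: B_def)
  also have "\<dots> \<le> Suc (card (\<Union>t\<in>{1..n}. quadruple_of ` B t))"
    by (simp add: B_def card_insert_if)
  also have "\<dots> \<le> Suc (\<Sum>t=1..n. card (B t))"
  proof -
    have "card (\<Union>t\<in>{1..n}. quadruple_of ` B t) \<le> (\<Sum>t=1..n. card (quadruple_of ` B t))"
      by (rule card_UN_le) simp
    also have "\<dots> \<le> (\<Sum>t=1..n. card (B t))"
      by (intro sum_mono card_image_le) (simp add: B_def)
    finally show ?thesis by simp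
  qed
  finally have "real (triangle_quadruple_count n) \<le> 1 + (\<Sum>t=1..n. real (card (B t)))"
    by (simp flip: of_nat_sum of_nat_Suc)
  \<comment> \<open>A box has at most \<open>9 * r\<^sup>2 = 18 * n / t\<close> points, so there are
    at most \<open>(18 * n / t)\<^sup>2\<close> pairs, and \<open>18\<^sup>2 = 324\<close>. As
    \<open>t \<le> n\<close>, the radius is at least 1.\<close>
  also have "(\<Sum>t=1..n. real (card (B t))) \<le> (\<Sum>t=1..n. 324 * (real n)\<^sup>2 * (1 / real t ^ 2))"
  proof (rule sum_mono)
    fix t assume t: "t \<in> {1..n}"
    define r where "r = sqrt (2 * real n / real t)"
    have "1 \<le> r" using t by (simp add: r_def field_simps)
    have r2: "r\<^sup>2 = 2 * real n / real t" by (simp add: r_def)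
    have "real (card (B t)) = (real (card (box r)))\<^sup>2"
      by (simp add: B_def r_def card_cartesian_product power2_eq_square)
    also have "\<dots> \<le> (9 * r\<^sup>2)\<^sup>2"
      using card_box_le[OF \<open>1 \<le> r\<close>] by (rule power_mono) simp
    also have "\<dots> = 324 * (real n)\<^sup>2 * (1 / real t ^ 2)"
      unfolding r2 by (simp add: power_mult_distrib power_divide)
    finally show "real (card (B t)) \<le> 324 * (real n)\<^sup>2 * (1 / real t ^ 2)" .
  qed
  also have "\<dots> = 324 * (real n)\<^sup>2 * (\<Sum>t=1..n. 1 / real t ^ 2)"
    by (simp only: sum_distrib_left)
  also have "\<dots> \<le> 324 * (real n)\<^sup>2 * (\<Sum>k. 1 / real k ^ 2)"
  proof (rule mult_left_mono)
    \<comment> \<open>The series starts at \<open>k = 0\<close>, where division by zero gives the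
      term 0.\<close>
    show "(\<Sum>t=1..n. 1 / real t ^ 2) \<le> (\<Sum>k. 1 / real k ^ 2)"
      using summable_inverse_squares by (rule sum_le_suminf) auto
  qed simp
  finally show ?thesis by (simp add: mult_ac)
qed

theorem theorem2:
  "(\<lambda>n::nat. real (triangle_quadruple_count n)) \<in> O(\<lambda>n. (real n)\<^sup>2 * (ln (real n)) ^ 3)"
proof (rule bigoI)
  define S :: real where "S = (\<Sum>k. 1 / real k ^ 2)"
  show "\<forall>\<^sub>F n in sequentially. norm (real (triangle_quadruple_count n))
    \<le> (1 + 324 * S) * norm ((real n)\<^sup>2 * (ln (real n)) ^ 3)"
    \<comment> \<open>From 3 on, \<open>n\<close> exceeds \<open>exp 1\<close>, so
      \<open>ln n \<ge> 1\<close> and the quadratic bound suffices; its constant 1 is absorbed by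
      \<open>n\<^sup>2\<close>.\<close>
    using eventually_ge_at_top[of 3]
  proof eventually_elim
    case (elim n)
    have "0 \<le> S"
      unfolding S_def using summable_inverse_squares by (rule suminf_nonneg) simp
    have "exp 1 \<le> real n"
      using exp_le elim by linarith
    then have "1 \<le> ln (real n)"
      using elim by (simp add: ln_ge_iff)
    then have "(real n)\<^sup>2 * 1 \<le> (real n)\<^sup>2 * (ln (real n)) ^ 3"
      by (intro mult_left_mono one_le_power) auto
    moreover have "1 \<le> (real n)\<^sup>2"
      using elim by (intro one_le_power) simp
    then have "real (triangle_quadruple_count n) \<le> (1 + 324 * S) * (real n)\<^sup>2"
      using triangle_quadruple_count_le[of n] by (simp add: S_def algebra_simps)
    ultimately show ?case
      using \<open>0 \<le> S\<close> \<open>1 \<le> ln (real n)\<close>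
      by (simp add: abs_mult) (smt (verit) mult_left_mono)
  qed
qed

end
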